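(* Let $p$ be a positive integer. The equilibrium solution $x=0$ of the stochastic system $x_{n+1}=T(x_n,\xi_n)$ is $p^{th}$ moment exponentially stable if and only if there exists a nonnegative function $V:X\to\mathbb R^{+}$ satisfying $$a\|x\|^p\le V(x)\le b\|x\|^p,\qquad [\mathbb U_TV](x)\le c\,V(x)\qquad (x\in X),$$ where $a,b,c$ are positive constants with $c<1$. Furthermore, (when $x=0$ is $p^{th}$ moment exponentially stable) such a $V$ can be expressed in terms of the resolvent of the Koopman operator as $$V(x)=[(I-\mathbb U_T)^{-1}f](x),\qquad f(x)=\|x\|^p .$$
   Context: Setting. $X\subset\mathbb{R}^d$ is compact with $0\in X$. The random vectors $\xi_0,\xi_1,\dots$ are i.i.d. with values in $W$ and common law $v$. The map $T:X\times W\to X$ is continuous in $x$ and, for each fixed $x$, measurable in $\xi$. $T(0,\xi)=0$ for all $\xi\in W$. There is also a standing local stability assumption: there is a neighborhood $\mathcal O$ of $0$ such that, for every deterministic initial condition $x_0\in\mathcal O$, $\mathrm{Prob}\{x_n\in\mathcal O\}=1$ for all $n\ge0$ and $\mathrm{Prob}\{\lim_{n\to\infty}x_n=0\}=1$. Koopman operator: $[\mathbb U_Th](x)=\int_Wh(T(x,y))\,dv(y)=E_\xi[h(T(x,\xi))]$; it is defined on continuous functions $h$ on $X$, and by the same formula for nonnegative Borel measurable functions ($V$ is understood to be Borel measurable). The function $(I-\mathbb U_T)^{-1}f$ is understood as the series $\sum_{k=0}^\infty\mathbb U_T^kf$. $p^{th}$ moment exponential stability of $x=0$: there exist positive constants $K<\infty$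 and $\beta<1$ such that $E_{\xi_0^n}[\|x_{n+1}\|^p]\le K\beta^n\|x_0\|^p$ for all $n\ge0$ and all initial conditions $x_0\in X$, where $x_{k+1}=T(x_k,\xi_k)$ and the expectation is over $\xi_0,\dots,\xi_n$. *)

theory Defs
  imports "HOL-Probability.Probability"
begin

primrec trajectory ::
  "('a \<Rightarrow> 'w \<Rightarrow> 'a) \<Rightarrow> (nat \<Rightarrow> 'o \<Rightarrow> 'w) \<Rightarrow> 'a \<Rightarrow> nat \<Rightarrow> 'o \<Rightarrow> 'a"
where
  "trajectory T \<xi> x0 0 \<omega> = x0"
| "trajectory T \<xi> x0 (Suc n) \<omega> = T (trajectory T \<xi> x0 n \<omega>) (\<xi> n \<omega>)"

text \<open>The noise space \<open>W\<close>, with its measurable sets, is carried by the law \<open>v\<close>: it is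
  \<open>space v\<close>. The map \<open>T\<close> is only constrained on \<open>X \<times> W\<close>. A neighborhood of the origin is
  understood relative to the state space \<open>X\<close> and need not itself be open.\<close>

locale stochastic_system = prob_space P
  for P :: "'o measure" +
  fixes v :: "'w measure"
    and \<xi> :: "nat \<Rightarrow> 'o \<Rightarrow> 'w"
    and X :: "'a::euclidean_space set"
    and T :: "'a \<Rightarrow> 'w \<Rightarrow> 'a"
  assumes compact_X: "compact X"
    and zero_in_X: "0 \<in> X"
    and noise_indep: "indep_vars (\<lambda>_. v) \<xi> UNIV"
    and noise_law: "distr P v (\<xi> n) = v"
    and T_into: "x \<in> X \<Longrightarrow> y \<in> space v \<Longrightarrow> T x y \<in> X"
    and T_continuous: "y \<in> space v \<Longrightarrow> continuous_on X (\<lambda>x. T x y)"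
    and T_measurable: "x \<in> X \<Longrightarrow> T x \<in> borel_measurable v"
    and T_zero: "y \<in> space v \<Longrightarrow> T 0 y = 0"
    and local_stability:
      "\<exists>N U. N \<subseteq> X \<and> openin (top_of_set X) U \<and> 0 \<in> U \<and> U \<subseteq> N \<and>
         (\<forall>x0\<in>N. (\<forall>n. \<P>(\<omega> in P. trajectory T \<xi> x0 n \<omega> \<in> N) = 1) \<and>
                  \<P>(\<omega> in P. (\<lambda>n. trajectory T \<xi> x0 n \<omega>) \<longlonglongrightarrow> 0) = 1)"

text \<open>In a \<open>stochastic_system\<close>, \<open>X\<close> is compact and \<open>T\<close> is jointly measurable on \<open>X \<times> W\<close>, being
  continuous in the state and measurable in the noise. Hence the Bochner integrals below (for
  \<open>koopman\<close>: applied to an \<open>h\<close> that is Borel measurable and bounded on \<open>X\<close>) have integrable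
  integrands and are never the default value for non-integrable functions.\<close>

definition koopman ::
  "'w measure \<Rightarrow> ('a \<Rightarrow> 'w \<Rightarrow> 'a) \<Rightarrow> ('a \<Rightarrow> real) \<Rightarrow> 'a \<Rightarrow> real"
where
  "koopman v T h x = (\<integral>y. h (T x y) \<partial>v)"

text \<open>The function \<open>(I - U)\<^sup>-\<^sup>1 f\<close>, where \<open>U = koopman v T\<close>, as a Neumann series; it is
  meaningful at \<open>x\<close> only if the series converges there.\<close>

definition koopman_resolvent ::
  "'w measure \<Rightarrow> ('a \<Rightarrow> 'w \<Rightarrow> 'a) \<Rightarrow> ('a \<Rightarrow> real) \<Rightarrow> 'a \<Rightarrow> real"
where
  "koopman_resolvent v T f x = (\<Sum>k. (koopman v T ^^ k) f x)"

definition moment_exp_stable ::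
  "'o measure \<Rightarrow> (nat \<Rightarrow> 'o \<Rightarrow> 'w) \<Rightarrow> 'a::euclidean_space set \<Rightarrow> ('a \<Rightarrow> 'w \<Rightarrow> 'a) \<Rightarrow> nat \<Rightarrow> bool"
where
  "moment_exp_stable P \<xi> X T p \<longleftrightarrow>
     (\<exists>K \<beta>::real. 0 < K \<and> 0 < \<beta> \<and> \<beta> < 1 \<and>
        (\<forall>x0\<in>X. \<forall>n. (\<integral>\<omega>. norm (trajectory T \<xi> x0 (Suc n) \<omega>) ^ p \<partial>P) \<le> K * \<beta> ^ n * norm x0 ^ p))"

definition lyapunov_function ::
  "'w measure \<Rightarrow> 'a::euclidean_space set \<Rightarrow> ('a \<Rightarrow> 'w \<Rightarrow> 'a) \<Rightarrow> nat \<Rightarrow> ('a \<Rightarrow> real) \<Rightarrow> bool"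
where
  "lyapunov_function v X T p V \<longleftrightarrow>
     V \<in> borel_measurable (restrict_space borel X) \<and> (\<forall>x\<in>X. 0 \<le> V x) \<and>
     (\<exists>a b c::real. 0 < a \<and> 0 < b \<and> 0 < c \<and> c < 1 \<and>
        (\<forall>x\<in>X. a * norm x ^ p \<le> V x \<and> V x \<le> b * norm x ^ p \<and> koopman v T V x \<le> c * V x))"

end

theory Submission
  imports Defs
begin

text \<open>
  The state \<open>x\<^sub>n\<close> is a function of \<open>\<xi>\<^sub>0, \<dots>, \<xi>\<^sub>n\<^sub>-\<^sub>1\<close> and hence independent of
  \<open>\<xi>\<^sub>n\<close>, so the expectation of \<open>h(x\<^sub>n\<^sub>+\<^sub>1) = h(T(x\<^sub>n, \<xi>\<^sub>n))\<close> can be computed by integrating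
  out the noise first, which gives \<open>E h(x\<^sub>n\<^sub>+\<^sub>1) = E (U h)(x\<^sub>n)\<close> with \<open>U\<close> the Koopman operator
  (\<open>expectation_trajectory_Suc\<close>) and, by iteration, \<open>E h(x\<^sub>n) = (U\<^sup>n h)(x\<^sub>0)\<close>
  (\<open>expectation_trajectory\<close>). Both directions are then short computations with \<open>f(x) = \<parallel>x\<parallel>\<^sup>p\<close>.

  If \<open>V\<close> is a Lyapunov function, then \<open>E V(x\<^sub>n\<^sub>+\<^sub>1) = E (U V)(x\<^sub>n) \<le> c E V(x\<^sub>n)\<close>, so \<open>E V(x\<^sub>n)\<close>
  decays like \<open>c\<^sup>n\<close>, and the two-sided comparison of \<open>V\<close> with \<open>f\<close> passes the decay on to the
  \<open>p\<close>-th moment, with \<open>K = b / a\<close> and \<open>\<beta> = c\<close>.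

  Conversely, stability says \<open>(U\<^sup>n\<^sup>+\<^sup>1 f)(x) \<le> K \<beta>\<^sup>n f(x)\<close>. The Neumann series
  \<open>V = f + U f + U\<^sup>2 f + \<dots>\<close> is therefore dominated by a geometric series, which gives
  \<open>f \<le> V \<le> b f\<close> with \<open>b = 1 + K / (1 - \<beta>)\<close>. Applying \<open>U\<close> removes the first term,
  \<open>U V = V - f\<close> (\<open>koopman_resolvent_eq\<close>), and \<open>f \<ge> V / b\<close> turns this into
  \<open>U V \<le> (1 - 1 / b) V\<close>.

  The integration over the noise is an application of Fubini's theorem and needs \<open>T\<close> to be
  measurable in both variables together. Separate continuity in the state and measurability in
  the noise suffice for this (\<open>caratheodory_borel_measurable\<close>).
\<close>

section \<open>Joint measurability of Caratheodory functions\<close>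

text \<open>Approximate \<open>x\<close> by the first point of a countable dense subset that lies within
  \<open>1 / (n + 1)\<close> of it. With \<open>x\<close> so replaced, \<open>T\<close> takes countably many measurable functions of
  \<open>y\<close> and chooses among them measurably in \<open>x\<close>; continuity in \<open>x\<close> makes these approximations
  converge to \<open>T\<close> pointwise.\<close>

lemma caratheodory_borel_measurable:
  fixes X :: "'a::{metric_space, second_countable_topology} set"
    and T :: "'a \<Rightarrow> 'w \<Rightarrow> 'b::metric_space"
  assumes cont: "\<And>y. y \<in> space M \<Longrightarrow> continuous_on X (\<lambda>x. T x y)"
    and meas: "\<And>x. x \<in> X \<Longrightarrow> T x \<in> borel_measurable M"
  shows "(\<lambda>z. T (fst z) (snd z)) \<in> borel_measurable (restrict_space borel X \<Otimes>\<^sub>M M)"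
proof (cases "X = {}")
  case True
  then have "space (restrict_space borel X \<Otimes>\<^sub>M M) = {}"
    by (simp add: space_pair_measure space_restrict_space)
  then show ?thesis
    by (auto simp: measurable_def)
next
  case False
  obtain D where D: "countable D" "D \<subseteq> X" "X \<subseteq> closure D"
    using separable by blast
  with False have "D \<noteq> {}" by auto
  define q where "q = from_nat_into D"
  have range_q: "range q = D"
    unfolding q_def using \<open>D \<noteq> {}\<close> \<open>countable D\<close> by (rule range_from_nat_into)
  then have q_in: "q k \<in> X" for k
    using D(2) by blast
  define near where "near n x = (LEAST k. dist x (q k) < 1 / real (Suc n))" for n x
  have near: "dist x (q (near n x)) < 1 / real (Suc n)" if "x \<in> X" for n x
  proof -
    have "x \<in> closure (range q)"
      using that D(3) range_q by auto
    then obtain k where "dist x (q k) < 1 / real (Suc n)"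
      unfolding closure_approachable
      by (metis dist_commute rangeE zero_less_divide_1_iff of_nat_0_less_iff zero_less_Suc)
    then show ?thesis
      unfolding near_def by (rule LeastI)
  qed
  have near_lim: "(\<lambda>n. q (near n x)) \<longlonglongrightarrow> x" if "x \<in> X" for x
  proof (rule metric_tendsto_imp_tendsto[OF LIMSEQ_inverse_real_of_nat])
    show "\<forall>\<^sub>F n in sequentially. dist (q (near n x)) x \<le> dist (inverse (real (Suc n))) 0"
      using near[OF that]
      by (intro always_eventually allI)
        (simp add: dist_commute inverse_eq_divide less_imp_le)
  qed
  let ?N = "restrict_space borel X \<Otimes>\<^sub>M M"
  have near_meas: "(\<lambda>z. near n (fst z)) \<in> ?N \<rightarrow>\<^sub>M count_space UNIV" for n
  proof -
    have "near n \<in> borel \<rightarrow>\<^sub>M count_space UNIV"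
      unfolding near_def by measurable
    then have "near n \<in> restrict_space borel X \<rightarrow>\<^sub>M count_space UNIV"
      by (rule measurable_restrict_space1)
    then show ?thesis by measurable
  qed
  show ?thesis
  proof (rule borel_measurable_LIMSEQ_metric)
    fix n
    have "(\<lambda>z. T (q k) (snd z)) \<in> borel_measurable ?N" for k
      using meas[OF q_in] by measurable
    then show "(\<lambda>z. T (q (near n (fst z))) (snd z)) \<in> borel_measurable ?N"
      by (rule measurable_compose_countable[OF _ near_meas])
  next
    fix z assume "z \<in> space ?N"
    then have z: "fst z \<in> X" "snd z \<in> space M"
      by (auto simp: space_pair_measure space_restrict_space)
    then show "(\<lambda>n. T (q (near n (fst z))) (snd z)) \<longlonglongrightarrow> T (fst z) (snd z)"
      by (intro continuous_on_tendsto_compose[OF cont]) (auto simp: near_lim q_in)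
  qed
qed

section \<open>The Koopman operator on bounded Borel functions\<close>

context stochastic_system
begin

abbreviation state_space :: "'a measure" where
  "state_space \<equiv> restrict_space borel X"

text \<open>On this class every integral below converges, and the Koopman operator preserves it. On a
  compact state space it contains the powers of the norm and every Lyapunov function. Values
  outside \<open>X\<close> are left arbitrary.\<close>

definition bounded_observable :: "('a \<Rightarrow> real) \<Rightarrow> bool" where
  "bounded_observable h \<longleftrightarrow>
     h \<in> borel_measurable state_space \<and> (\<exists>B. \<forall>x\<in>X. \<bar>h x\<bar> \<le> B)"

lemma noise_measurable: "\<xi> n \<in> P \<rightarrow>\<^sub>M v"
  using noise_indep by (simp add: indep_vars_def)

lemma prob_space_noise_law: "prob_space v"
  using prob_space_distr[OF noise_measurable[of 0]] noise_law[of 0] by simp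

lemma space_state_space [simp]: "space state_space = X"
  by (simp add: space_restrict_space)

lemma T_jointly_measurable:
  "(\<lambda>z. T (fst z) (snd z)) \<in> state_space \<Otimes>\<^sub>M v \<rightarrow>\<^sub>M state_space"
  by (intro measurable_restrict_space2 caratheodory_borel_measurable T_continuous T_measurable)
    (auto simp: space_pair_measure T_into)

lemma T_measurable_state:
  assumes "f \<in> M \<rightarrow>\<^sub>M state_space" and "g \<in> M \<rightarrow>\<^sub>M v"
  shows "(\<lambda>\<omega>. T (f \<omega>) (g \<omega>)) \<in> M \<rightarrow>\<^sub>M state_space"
  using measurable_compose[OF measurable_Pair[OF assms] T_jointly_measurable] by simp

lemma koopman_integrable:
  assumes "bounded_observable h" and "x \<in> X"
  shows "integrable v (\<lambda>y. h (T x y))"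
proof -
  interpret v: prob_space v by (rule prob_space_noise_law)
  obtain B where B: "\<forall>x\<in>X. \<bar>h x\<bar> \<le> B" and h: "h \<in> borel_measurable state_space"
    using assms(1) by (auto simp: bounded_observable_def)
  have "T x \<in> v \<rightarrow>\<^sub>M state_space"
    using T_measurable_state[of "\<lambda>_. x" v "\<lambda>y. y"] \<open>x \<in> X\<close> by simp
  then show ?thesis
    using B T_into[OF \<open>x \<in> X\<close>]
    by (intro v.integrable_const_bound[of _ B] AE_I2 measurable_compose[OF _ h]) auto
qed

lemma bounded_observable_koopman:
  assumes "bounded_observable h"
  shows "bounded_observable (koopman v T h)"
proof -
  interpret v: prob_space v by (rule prob_space_noise_law)
  obtain B where B: "\<forall>x\<in>X. \<bar>h x\<bar> \<le> B" and h: "h \<in> borel_measurable state_space"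
    using assms by (auto simp: bounded_observable_def)
  have "(\<lambda>(x, y). h (T x y)) \<in> borel_measurable (state_space \<Otimes>\<^sub>M v)"
    using measurable_compose[OF T_jointly_measurable h] by (simp add: case_prod_beta)
  then have "koopman v T h \<in> borel_measurable state_space"
    unfolding koopman_def by (rule v.borel_measurable_lebesgue_integral)
  moreover have "\<bar>koopman v T h x\<bar> \<le> B" if "x \<in> X" for x
  proof -
    have "\<bar>koopman v T h x\<bar> \<le> (\<integral>y. \<bar>h (T x y)\<bar> \<partial>v)"
      unfolding koopman_def by (rule integral_abs_bound)
    also have "\<dots> \<le> B"
      using B T_into[OF that] koopman_integrable[OF assms that]
      by (intro v.integral_le_const integrable_abs AE_I2) auto
    finally show ?thesis .
  qed
  ultimately show ?thesis
    by (auto simp: bounded_observable_def)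
qed

lemma bounded_observable_koopman_pow:
  "bounded_observable h \<Longrightarrow> bounded_observable ((koopman v T ^^ k) h)"
  by (induction k) (simp_all add: bounded_observable_koopman)

lemma bounded_observable_norm_pow: "bounded_observable (\<lambda>x. norm x ^ p)"
proof -
  obtain B where B: "\<forall>x\<in>X. norm x \<le> B"
    using compact_imp_bounded[OF compact_X] by (auto simp: bounded_iff)
  then have "\<forall>x\<in>X. \<bar>norm x ^ p\<bar> \<le> B ^ p"
    by (auto intro: power_mono)
  moreover have "(\<lambda>x. norm x ^ p) \<in> borel_measurable state_space"
    by (rule measurable_restrict_space1) simp
  ultimately show ?thesis
    by (auto simp: bounded_observable_def)
qed

lemma koopman_pow_nonneg:
  assumes "\<And>x. x \<in> X \<Longrightarrow> 0 \<le> h x" and "x \<in> X"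
  shows "0 \<le> (koopman v T ^^ k) h x"
  using assms(2)
proof (induction k arbitrary: x)
  case 0
  then show ?case using assms(1) by simp
next
  case (Suc k)
  then show ?case
    by (auto simp: koopman_def[of v T "(koopman v T ^^ k) h"] T_into intro!: integral_nonneg_AE AE_I2)
qed

section \<open>The trajectory as a Markov chain\<close>

text \<open>The state at time \<open>n\<close> is the trajectory driven by the coordinate process on noise sequences,
  evaluated at the first \<open>n\<close> noise values; this is the form in which independence of the
  noise can be applied to it.\<close>

lemma trajectory_restrict:
  "trajectory T \<xi> x0 n \<omega> =
     trajectory T (\<lambda>i w. w i) x0 n (restrict (\<lambda>i. \<xi> i \<omega>) {..<n})"
proof -
  have "k \<le> n \<Longrightarrow> trajectory T \<xi> x0 k \<omega> =
     trajectory T (\<lambda>i w. w i) x0 k (restrict (\<lambda>i. \<xi> i \<omega>) {..<n})" for k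
    by (induction k) auto
  then show ?thesis by simp
qed

text \<open>The driving process \<open>\<eta>\<close> is arbitrary because the lemma is needed twice: for \<open>\<xi>\<close> itself and
  for the coordinate process on the product space of noise sequences.\<close>

lemma trajectory_measurable_general:
  assumes "x0 \<in> X" and "\<And>i. i < n \<Longrightarrow> \<eta> i \<in> M \<rightarrow>\<^sub>M v"
  shows "trajectory T \<eta> x0 n \<in> M \<rightarrow>\<^sub>M state_space"
  using assms(2)
proof (induction n)
  case 0
  have "trajectory T \<eta> x0 0 = (\<lambda>\<omega>. x0)" by (rule ext) simp
  then show ?case using assms(1) by simp
next
  case (Suc n)
  have "trajectory T \<eta> x0 (Suc n) = (\<lambda>\<omega>. T (trajectory T \<eta> x0 n \<omega>) (\<eta> n \<omega>))"
    by (rule ext) simp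
  then show ?case
    using Suc by (simp add: T_measurable_state)
qed

lemmas trajectory_measurable = trajectory_measurable_general[OF _ noise_measurable]

lemma trajectory_in_X:
  "x0 \<in> X \<Longrightarrow> \<omega> \<in> space P \<Longrightarrow> trajectory T \<xi> x0 n \<omega> \<in> X"
  using measurable_space[OF trajectory_measurable] by simp

lemma integrable_trajectory:
  assumes "bounded_observable h" and "x0 \<in> X"
  shows "integrable P (\<lambda>\<omega>. h (trajectory T \<xi> x0 n \<omega>))"
proof -
  obtain B where B: "\<forall>x\<in>X. \<bar>h x\<bar> \<le> B" and h: "h \<in> borel_measurable state_space"
    using assms(1) by (auto simp: bounded_observable_def)
  show ?thesis
    using B trajectory_in_X[OF \<open>x0 \<in> X\<close>]
    by (intro integrable_const_bound[of _ B] AE_I2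
        measurable_compose[OF trajectory_measurable[OF \<open>x0 \<in> X\<close>] h]) auto
qed

text \<open>This is independence of \<open>x\<^sub>n\<close> and \<open>\<xi>\<^sub>n\<close>. The blocks \<open>(\<xi>\<^sub>i)\<close> with \<open>i < n\<close> and with \<open>i = n\<close> are
  independent, and \<open>x\<^sub>n\<close> and \<open>\<xi>\<^sub>n\<close> are measurable functions of one block each. The product law is
  transported along these two functions directly, because the predicate for independence of a
  pair requires both variables to have values of the same type, which holds for the blocks but
  not for a state and a noise value.\<close>

lemma trajectory_noise_joint_law:
  assumes "x0 \<in> X"
  shows "distr P (state_space \<Otimes>\<^sub>M v) (\<lambda>\<omega>. (trajectory T \<xi> x0 n \<omega>, \<xi> n \<omega>)) =
         distr P state_space (trajectory T \<xi> x0 n) \<Otimes>\<^sub>M v"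
proof -
  let ?A = "PiM {..<n} (\<lambda>_. v)" and ?B = "PiM {n} (\<lambda>_. v)"
  let ?a = "\<lambda>\<omega>. restrict (\<lambda>i. \<xi> i \<omega>) {..<n}" and ?b = "\<lambda>\<omega>. restrict (\<lambda>i. \<xi> i \<omega>) {n}"
  let ?f = "trajectory T (\<lambda>i w. w i) x0 n" and ?g = "\<lambda>w::nat \<Rightarrow> 'w. w n"
  have f: "?f \<in> ?A \<rightarrow>\<^sub>M state_space"
    by (rule trajectory_measurable_general[OF assms]) (simp add: measurable_component_singleton)
  have g: "?g \<in> ?B \<rightarrow>\<^sub>M v"
    by (simp add: measurable_component_singleton)
  have a: "?a \<in> P \<rightarrow>\<^sub>M ?A" and b: "?b \<in> P \<rightarrow>\<^sub>M ?B"
    by (simp_all add: measurable_restrict noise_measurable)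
  have fa: "?f (?a \<omega>) = trajectory T \<xi> x0 n \<omega>" for \<omega>
    by (rule trajectory_restrict[symmetric])
  have "indep_var ?A ?a ?B ?b"
    by (rule indep_var_restrict[OF noise_indep]) auto
  then have joint: "distr P (?A \<Otimes>\<^sub>M ?B) (\<lambda>\<omega>. (?a \<omega>, ?b \<omega>)) = distr P ?A ?a \<Otimes>\<^sub>M distr P ?B ?b"
    by (simp add: indep_var_distribution_eq)
  have f': "?f \<in> distr P ?A ?a \<rightarrow>\<^sub>M state_space" and g': "?g \<in> distr P ?B ?b \<rightarrow>\<^sub>M v"
    using f g by (simp_all cong: measurable_cong_sets)
  have law_f: "distr (distr P ?A ?a) state_space ?f = distr P state_space (trajectory T \<xi> x0 n)"
    by (subst distr_distr[OF f a]) (simp add: comp_def fa)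
  have law_g: "distr (distr P ?B ?b) v ?g = v"
    by (subst distr_distr[OF g b]) (simp add: comp_def noise_law)
  have "sigma_finite_measure (distr (distr P ?B ?b) v ?g)"
    unfolding law_g using prob_space_noise_law by (rule prob_space_imp_sigma_finite)
  from pair_measure_distr[OF f' g' this]
  have "distr P state_space (trajectory T \<xi> x0 n) \<Otimes>\<^sub>M v =
        distr (distr P (?A \<Otimes>\<^sub>M ?B) (\<lambda>\<omega>. (?a \<omega>, ?b \<omega>))) (state_space \<Otimes>\<^sub>M v)
          (\<lambda>(x, y). (?f x, ?g y))"
    unfolding law_f law_g joint .
  also have "\<dots> = distr P (state_space \<Otimes>\<^sub>M v) (\<lambda>\<omega>. (trajectory T \<xi> x0 n \<omega>, \<xi> n \<omega>))"
  proof (subst distr_distr)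
    show "(\<lambda>\<omega>. (?a \<omega>, ?b \<omega>)) \<in> P \<rightarrow>\<^sub>M ?A \<Otimes>\<^sub>M ?B"
      using a b by (rule measurable_Pair)
    show "(\<lambda>(x, y). (?f x, ?g y)) \<in> ?A \<Otimes>\<^sub>M ?B \<rightarrow>\<^sub>M state_space \<Otimes>\<^sub>M v"
      unfolding case_prod_beta
      by (intro measurable_Pair measurable_compose[OF measurable_fst f]
          measurable_compose[OF measurable_snd g])
  qed (simp add: comp_def fa)
  finally show ?thesis by simp
qed

text \<open>The Markov property in expectation form: Fubini's theorem for the product law of
  \<open>x\<^sub>n\<close> and \<open>\<xi>\<^sub>n\<close>, with the noise integrated first.\<close>

lemma expectation_trajectory_Suc:
  assumes h: "bounded_observable h" and "x0 \<in> X"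
  shows "expectation (\<lambda>\<omega>. h (trajectory T \<xi> x0 (Suc n) \<omega>)) =
         expectation (\<lambda>\<omega>. koopman v T h (trajectory T \<xi> x0 n \<omega>))"
proof -
  let ?x = "trajectory T \<xi> x0 n"
  let ?\<mu> = "distr P state_space ?x"
  have x_meas: "?x \<in> P \<rightarrow>\<^sub>M state_space"
    by (rule trajectory_measurable[OF \<open>x0 \<in> X\<close>])
  interpret v: prob_space v by (rule prob_space_noise_law)
  interpret \<mu>: prob_space ?\<mu> by (rule prob_space_distr[OF x_meas])
  interpret \<mu>v: pair_prob_space ?\<mu> v ..
  obtain B where B: "\<forall>x\<in>X. \<bar>h x\<bar> \<le> B" and h_meas: "h \<in> borel_measurable state_space"
    using h by (auto simp: bounded_observable_def)
  have hT: "(\<lambda>z. h (T (fst z) (snd z))) \<in> borel_measurable (state_space \<Otimes>\<^sub>M v)"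
    by (rule measurable_compose[OF T_jointly_measurable h_meas])
  then have hT': "(\<lambda>z. h (T (fst z) (snd z))) \<in> borel_measurable (?\<mu> \<Otimes>\<^sub>M v)"
    by (simp cong: measurable_cong_sets sets_pair_measure_cong)
  have int: "integrable (?\<mu> \<Otimes>\<^sub>M v) (\<lambda>z. h (T (fst z) (snd z)))"
    using B T_into
    by (intro \<mu>v.integrable_const_bound[of _ B] AE_I2 hT') (auto simp: space_pair_measure)
  have joint_law: "?\<mu> \<Otimes>\<^sub>M v = distr P (state_space \<Otimes>\<^sub>M v) (\<lambda>\<omega>. (?x \<omega>, \<xi> n \<omega>))"
    by (rule trajectory_noise_joint_law[OF \<open>x0 \<in> X\<close>, symmetric])
  have "expectation (\<lambda>\<omega>. h (trajectory T \<xi> x0 (Suc n) \<omega>)) =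
        (\<integral>z. h (T (fst z) (snd z)) \<partial>(?\<mu> \<Otimes>\<^sub>M v))"
    unfolding joint_law
    by (subst integral_distr[OF measurable_Pair[OF x_meas noise_measurable] hT]) simp
  also have "\<dots> = (\<integral>x. koopman v T h x \<partial>?\<mu>)"
    using \<mu>v.integral_fst'[OF int] by (simp add: koopman_def)
  also have "\<dots> = expectation (\<lambda>\<omega>. koopman v T h (?x \<omega>))"
    using bounded_observable_koopman[OF h]
    by (intro integral_distr[OF x_meas]) (simp add: bounded_observable_def)
  finally show ?thesis .
qed

lemma expectation_trajectory:
  assumes "bounded_observable h" and "x0 \<in> X"
  shows "expectation (\<lambda>\<omega>. h (trajectory T \<xi> x0 n \<omega>)) = (koopman v T ^^ n) h x0"
  using assms(1)
proof (induction n arbitrary: h)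
  case 0
  show ?case by (simp add: prob_space)
next
  case (Suc n)
  then show ?case
    using bounded_observable_koopman
    by (simp only: expectation_trajectory_Suc[OF _ assms(2)] funpow_Suc_right o_apply)
qed

section \<open>Lyapunov functions and moment stability\<close>

text \<open>The expectation of \<open>V\<close> along a trajectory shrinks by the factor \<open>c\<close> in each step, and \<open>V\<close>
  is comparable with the \<open>p\<close>-th power of the norm.\<close>

lemma lyapunov_imp_moment_exp_stable:
  assumes "lyapunov_function v X T p V"
  shows "moment_exp_stable P \<xi> X T p"
proof -
  obtain a b c where abc: "0 < a" "0 < b" "0 < c" "c < 1"
    and lower: "\<And>x. x \<in> X \<Longrightarrow> a * norm x ^ p \<le> V x"
    and upper: "\<And>x. x \<in> X \<Longrightarrow> V x \<le> b * norm x ^ p"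
    and decrease: "\<And>x. x \<in> X \<Longrightarrow> koopman v T V x \<le> c * V x"
    and V_meas: "V \<in> borel_measurable state_space"
    and V_nonneg: "\<And>x. x \<in> X \<Longrightarrow> 0 \<le> V x"
    using assms by (auto simp: lyapunov_function_def)
  obtain B where B: "\<forall>x\<in>X. \<bar>norm x ^ p\<bar> \<le> B"
    using bounded_observable_norm_pow[of p] by (auto simp: bounded_observable_def)
  have "\<bar>V x\<bar> \<le> b * B" if "x \<in> X" for x
    using upper[OF that] V_nonneg[OF that] B[rule_format, OF that] \<open>0 < b\<close>
    by (smt (verit) mult_left_mono)
  then have V: "bounded_observable V"
    using V_meas by (auto simp: bounded_observable_def)
  have decay: "expectation (\<lambda>\<omega>. V (trajectory T \<xi> x0 n \<omega>)) \<le> c ^ n * V x0"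
    if "x0 \<in> X" for x0 n
  proof (induction n)
    case 0
    show ?case by (simp add: prob_space)
  next
    case (Suc n)
    have "expectation (\<lambda>\<omega>. V (trajectory T \<xi> x0 (Suc n) \<omega>)) =
          expectation (\<lambda>\<omega>. koopman v T V (trajectory T \<xi> x0 n \<omega>))"
      by (rule expectation_trajectory_Suc[OF V that])
    also have "\<dots> \<le> expectation (\<lambda>\<omega>. c * V (trajectory T \<xi> x0 n \<omega>))"
      using V bounded_observable_koopman[OF V] decrease trajectory_in_X[OF that]
      by (intro integral_mono integrable_mult_right integrable_trajectory that) auto
    also have "\<dots> \<le> c * (c ^ n * V x0)"
      using Suc.IH \<open>0 < c\<close> by simp
    finally show ?case by (simp add: mult.assoc)
  qed
  have "expectation (\<lambda>\<omega>. norm (trajectory T \<xi> x0 (Suc n) \<omega>) ^ p) \<le> b / a * c ^ n * norm x0 ^ p"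
    if "x0 \<in> X" for x0 n
  proof -
    have "a * expectation (\<lambda>\<omega>. norm (trajectory T \<xi> x0 (Suc n) \<omega>) ^ p) =
          expectation (\<lambda>\<omega>. a * norm (trajectory T \<xi> x0 (Suc n) \<omega>) ^ p)"
      by simp
    also have "\<dots> \<le> expectation (\<lambda>\<omega>. V (trajectory T \<xi> x0 (Suc n) \<omega>))"
      using lower trajectory_in_X[OF that, of _ "Suc n"]
        integrable_trajectory[OF bounded_observable_norm_pow that]
      by (intro integral_mono integrable_mult_right integrable_trajectory[OF V that]) blast+
    also have "\<dots> \<le> c ^ Suc n * V x0"
      by (rule decay[OF that])
    \<comment> \<open>The stability bound counts from \<open>x\<^sub>1\<close>, so one factor \<open>c < 1\<close> is given away here.\<close>
    also have "\<dots> \<le> c ^ n * (b * norm x0 ^ p)"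
      using abc upper[OF that] V_nonneg[OF that]
      by (intro mult_mono power_decreasing) auto
    finally show ?thesis
      using \<open>0 < a\<close> by (simp add: field_simps)
  qed
  then have "0 < b / a \<and> 0 < c \<and> c < 1 \<and> (\<forall>x0\<in>X. \<forall>n.
      expectation (\<lambda>\<omega>. norm (trajectory T \<xi> x0 (Suc n) \<omega>) ^ p) \<le> b / a * c ^ n * norm x0 ^ p)"
    using abc by simp
  then show ?thesis
    unfolding moment_exp_stable_def by blast
qed

text \<open>The resolvent equation \<open>(I - U) (I - U)\<^sup>-\<^sup>1 h = h\<close>. Since all terms of the Neumann series are
  nonnegative, pointwise convergence of the series is enough to integrate it term by term, and
  \<open>U\<close> shifts it by one place.\<close>

lemma koopman_resolvent_eq:
  assumes h: "bounded_observable h"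
    and h_nonneg: "\<And>x. x \<in> X \<Longrightarrow> 0 \<le> h x"
    and summable: "\<And>x. x \<in> X \<Longrightarrow> summable (\<lambda>k. (koopman v T ^^ k) h x)"
    and "x \<in> X"
  shows "koopman v T (koopman_resolvent v T h) x = koopman_resolvent v T h x - h x"
proof -
  let ?g = "\<lambda>k. (koopman v T ^^ k) h"
  have g: "bounded_observable (?g k)" for k
    using h by (rule bounded_observable_koopman_pow)
  have g_nonneg: "0 \<le> ?g k z" if "z \<in> X" for k z
    using h_nonneg that by (rule koopman_pow_nonneg)
  have step: "(\<integral>y. ?g k (T x y) \<partial>v) = ?g (Suc k) x" for k
    by (simp add: koopman_def[of v T "?g k"])
  have norm_step: "(\<integral>y. norm (?g k (T x y)) \<partial>v) = ?g (Suc k) x" for k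
    unfolding step[symmetric]
    by (rule Bochner_Integration.integral_cong) (auto simp: g_nonneg T_into \<open>x \<in> X\<close>)
  have shifted: "summable (\<lambda>k. ?g (Suc k) x)"
    using summable[OF \<open>x \<in> X\<close>] by (subst summable_Suc_iff)
  have "koopman v T (koopman_resolvent v T h) x = (\<integral>y. (\<Sum>k. ?g k (T x y)) \<partial>v)"
    by (simp add: koopman_def[of v T "koopman_resolvent v T h"] koopman_resolvent_def)
  also have "\<dots> = (\<Sum>k. \<integral>y. ?g k (T x y) \<partial>v)"
  proof (rule integral_suminf)
    show "integrable v (\<lambda>y. ?g k (T x y))" for k
      by (rule koopman_integrable[OF g \<open>x \<in> X\<close>])
    show "AE y in v. summable (\<lambda>k. norm (?g k (T x y)))"
      using summable[OF T_into[OF \<open>x \<in> X\<close>]] g_nonneg[OF T_into[OF \<open>x \<in> X\<close>]]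
      by (intro AE_I2) simp
    show "summable (\<lambda>k. \<integral>y. norm (?g k (T x y)) \<partial>v)"
      unfolding norm_step by (rule shifted)
  qed
  also have "\<dots> = (\<Sum>k. ?g (Suc k) x)"
    unfolding step ..
  also have "\<dots> = koopman_resolvent v T h x - h x"
    unfolding koopman_resolvent_def
    using suminf_split_head[OF summable[OF \<open>x \<in> X\<close>]] by simp
  finally show ?thesis .
qed

text \<open>Stability bounds the tail of the Neumann series by \<open>K f(x)\<close> times the geometric series in
  \<open>\<beta>\<close>. The resulting constants are \<open>a = 1\<close>, because the series begins with \<open>f\<close>,
  \<open>b = 1 + K / (1 - \<beta>)\<close> and \<open>c = 1 - 1 / b\<close>.\<close>

lemma moment_exp_stable_imp_resolvent_lyapunov:
  assumes "moment_exp_stable P \<xi> X T p"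
  shows moment_exp_stable_imp_summable:
      "x \<in> X \<Longrightarrow> summable (\<lambda>k. (koopman v T ^^ k) (\<lambda>x. norm x ^ p) x)"
    and moment_exp_stable_imp_lyapunov:
      "lyapunov_function v X T p (koopman_resolvent v T (\<lambda>x. norm x ^ p))"
proof -
  let ?f = "\<lambda>x::'a. norm x ^ p"
  let ?g = "\<lambda>k. (koopman v T ^^ k) ?f"
  let ?V = "koopman_resolvent v T ?f"
  obtain K \<beta> where K: "0 < K" and \<beta>: "0 < \<beta>" "\<beta> < 1"
    and stable: "\<And>x n. x \<in> X \<Longrightarrow>
      expectation (\<lambda>\<omega>. norm (trajectory T \<xi> x (Suc n) \<omega>) ^ p) \<le> K * \<beta> ^ n * norm x ^ p"
    using assms by (auto simp: moment_exp_stable_def)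
  note f = bounded_observable_norm_pow[of p]
  have g_le: "?g (Suc k) x \<le> K * ?f x * \<beta> ^ k" if "x \<in> X" for x k
    using stable[OF that, of k] expectation_trajectory[OF f that, of "Suc k"]
    by (simp add: mult.commute mult.left_commute)
  have g_nonneg: "0 \<le> ?g k x" if "x \<in> X" for x k
    using that by (intro koopman_pow_nonneg) simp
  have geometric: "(\<lambda>k. K * ?f x * \<beta> ^ k) sums (K * ?f x * (1 / (1 - \<beta>)))" for x
    using \<beta> by (intro sums_mult geometric_sums) simp
  have shifted: "summable (\<lambda>k. ?g (Suc k) x)" if "x \<in> X" for x
    using g_nonneg[OF that] g_le[OF that]
    by (intro summable_comparison_test'[OF sums_summable[OF geometric], of 0]) (simp del: funpow.simps)
  show summable: "summable (\<lambda>k. ?g k x)" if "x \<in> X" for x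
    using shifted[OF that] by (subst (asm) summable_Suc_iff)
  have V_split: "?V x = ?f x + (\<Sum>k. ?g (Suc k) x)" if "x \<in> X" for x
    unfolding koopman_resolvent_def using suminf_split_head[OF summable[OF that]] by simp
  have lower: "?f x \<le> ?V x" if "x \<in> X" for x
    unfolding V_split[OF that]
    using suminf_nonneg[OF shifted[OF that] g_nonneg[OF that]] by simp
  define b where "b = 1 + K / (1 - \<beta>)"
  have "1 < b"
    using K \<beta> by (simp add: b_def)
  have upper: "?V x \<le> b * ?f x" if "x \<in> X" for x
  proof -
    have "(\<Sum>k. ?g (Suc k) x) \<le> K * ?f x * (1 / (1 - \<beta>))"
      using suminf_le[OF g_le[OF that] shifted[OF that] sums_summable[OF geometric]]
        sums_unique[OF geometric[of x]] by simp
    then show ?thesis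
      unfolding V_split[OF that] by (simp add: b_def algebra_simps)
  qed
  have decrease: "koopman v T ?V x \<le> (1 - 1 / b) * ?V x" if "x \<in> X" for x
  proof -
    have "koopman v T ?V x = ?V x - ?f x"
      using f summable that by (intro koopman_resolvent_eq) auto
    moreover have "?V x / b \<le> ?f x"
      using upper[OF that] \<open>1 < b\<close> by (simp add: field_simps)
    ultimately show ?thesis
      by (simp add: algebra_simps)
  qed
  have "?V \<in> borel_measurable state_space"
    unfolding koopman_resolvent_def
    using bounded_observable_koopman_pow[OF f]
    by (intro borel_measurable_suminf) (simp add: bounded_observable_def)
  moreover have "0 \<le> ?V x" if "x \<in> X" for x
    using lower[OF that] by (rule order_trans[rotated]) simp
  moreover have "\<exists>a b c::real. 0 < a \<and> 0 < b \<and> 0 < c \<and> c < 1 \<and>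
      (\<forall>x\<in>X. a * ?f x \<le> ?V x \<and> ?V x \<le> b * ?f x \<and> koopman v T ?V x \<le> c * ?V x)"
    by (rule exI[of _ 1], rule exI[of _ b], rule exI[of _ "1 - 1 / b"])
      (use lower upper decrease \<open>1 < b\<close> in simp)
  ultimately show "lyapunov_function v X T p ?V"
    unfolding lyapunov_function_def by simp
qed

end

theorem theorem21:
  fixes P :: "'o measure"
    and v :: "'w measure"
    and \<xi> :: "nat \<Rightarrow> 'o \<Rightarrow> 'w"
    and X :: "'a::euclidean_space set"
    and T :: "'a \<Rightarrow> 'w \<Rightarrow> 'a"
    and p :: nat
  assumes "stochastic_system P v \<xi> X T"
    and "p > 0"
  shows "(moment_exp_stable P \<xi> X T p \<longleftrightarrow> (\<exists>V. lyapunov_function v X T p V)) \<and>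
    (moment_exp_stable P \<xi> X T p \<longrightarrow>
       (\<forall>x\<in>X. summable (\<lambda>k. (koopman v T ^^ k) (\<lambda>x. norm x ^ p) x)) \<and>
       lyapunov_function v X T p (koopman_resolvent v T (\<lambda>x. norm x ^ p)))"
proof -
  interpret stochastic_system P v \<xi> X T by fact
  show ?thesis
  proof (intro conjI iffI impI ballI)
    assume stable: "moment_exp_stable P \<xi> X T p"
    show lyapunov: "lyapunov_function v X T p (koopman_resolvent v T (\<lambda>x. norm x ^ p))"
      by (rule moment_exp_stable_imp_lyapunov[OF stable])
    show "\<exists>V. lyapunov_function v X T p V"
      by (rule exI[where P = "lyapunov_function v X T p", OF lyapunov])
    show "summable (\<lambda>k. (koopman v T ^^ k) (\<lambda>x. norm x ^ p) x)" if "x \<in> X" for x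
      by (rule moment_exp_stable_imp_summable[OF stable that])
  next
    assume "\<exists>V. lyapunov_function v X T p V"
    then show "moment_exp_stable P \<xi> X T p"
      by (elim exE lyapunov_imp_moment_exp_stable)
  qed
qed

end
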